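(* For all integers $d \geq 2$, there exists a compact set $U \subseteq \mathbb{R}^d$ such that there is a set of lines $\mathcal{L}$ with non-empty interior in the $2(d-1)$-dimensional manifold of all (affine) lines in $\mathbb{R}^d$ such that $U$ intersects every line in $\mathcal{L}$ in a set of positive length, but yet $\dim_{\mathrm{F}} U = 0$.
   Context: For a finite non-zero Borel measure $\mu$ on $\mathbb{R}^d$, $\widehat\mu(z)=\int e^{-2\pi i z\cdot x}\,d\mu(x)$, $\mathrm{spt}(\mu)$ is the support of $\mu$, and the Fourier dimension of $\mu$ is $\dim_{\mathrm{F}}\mu = \sup\{s\geq 0 : \exists\, c>0,\ |\widehat\mu(z)|\leq c|z|^{-s/2} \text{ for all } z\neq 0\}$. For $X\subseteq\mathbb{R}^d$, $\dim_{\mathrm{F}} X = \sup\{\min\{\dim_{\mathrm{F}}\mu, d\} : \mathrm{spt}(\mu)\subseteq X\}$, the supremum being over finite non-zero Borel measures $\mu$ supported by $X$. "Positive length" means positive one-dimensional Lebesgue measure on the line. *)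

theory Defs
  imports "HOL-Analysis.Analysis"
begin

definition nonzero_finite_borel_measure :: "'a::euclidean_space measure \<Rightarrow> bool" where
  "nonzero_finite_borel_measure M \<longleftrightarrow>
     finite_measure M \<and> sets M = sets borel \<and> emeasure M (space M) \<noteq> 0"

definition fourier_transform :: "'a::euclidean_space measure \<Rightarrow> 'a \<Rightarrow> complex" where
  "fourier_transform M z = (\<integral>x. exp (- 2 * of_real pi * \<i> * of_real (z \<bullet> x)) \<partial>M)"

definition measure_support :: "'a::euclidean_space measure \<Rightarrow> 'a set" where
  "measure_support M = {x. \<forall>V. open V \<longrightarrow> x \<in> V \<longrightarrow> emeasure M V > 0}"

text \<open>The dimension of a measure may be infinite. The order of \<^typ>\<open>ennreal\<close> is that of
  the extended half-line, so the supremum in \<open>fourier_dim\<close> for a set carrying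
  no measure, i.e. the empty set, is \<open>0\<close>.\<close>

definition fourier_dim_measure :: "'a::euclidean_space measure \<Rightarrow> ennreal" where
  "fourier_dim_measure M =
     Sup (ennreal ` {s. s \<ge> 0 \<and>
       (\<exists>c>0. \<forall>z. z \<noteq> 0 \<longrightarrow> norm (fourier_transform M z) \<le> c * norm z powr (- s / 2))})"

definition fourier_dim :: "'a::euclidean_space set \<Rightarrow> ennreal" where
  "fourier_dim X =
     Sup ((\<lambda>M. min (fourier_dim_measure M) (of_nat DIM('a))) `
       {M. nonzero_finite_borel_measure M \<and> measure_support M \<subseteq> X})"

definition affine_lines :: "'a::euclidean_space set set" where
  "affine_lines = {l. affine l \<and> aff_dim l = 1}"

definition line_through :: "'a::euclidean_space \<Rightarrow> 'a \<Rightarrow> 'a set" where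
  "line_through x v = range (\<lambda>t. x + t *\<^sub>R v)"

lemma line_through_conv_affine_hull: "line_through x v = affine hull {x, x + v}"
proof -
  have "affine hull {x, x + v} = {u *\<^sub>R x + t *\<^sub>R (x + v) | u t. u + t = 1}"
    by (rule affine_hull_2)
  also have "\<dots> = range (\<lambda>t. x + t *\<^sub>R v)"
  proof (safe, goal_cases)
    case (1 y u t)
    have "u *\<^sub>R x + t *\<^sub>R (x + v) = (u + t) *\<^sub>R x + t *\<^sub>R v"
      by (simp only: scaleR_add_left scaleR_add_right add.assoc)
    then show ?case using 1 by auto
  next
    case (2 y t)
    have "x + t *\<^sub>R v = (1 - t) *\<^sub>R x + t *\<^sub>R (x + v)"
      by (simp add: algebra_simps)
    then show ?case by (metis diff_add_cancel)
  qed
  finally show ?thesis by (simp add: line_through_def)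
qed

lemma affine_lines_eq: "affine_lines = {line_through x v | x v. v \<noteq> 0}"
proof (intro set_eqI iffI)
  fix l :: "'a set"
  assume "l \<in> affine_lines"
  then have l: "affine l" "aff_dim l = 1" by (auto simp: affine_lines_def)
  obtain a where a: "a \<in> l" using l(2) by fastforce
  have "l \<noteq> {a}" using l(2) by auto
  then obtain b where b: "b \<in> l" "b \<noteq> a" using a by blast
  have "affine hull {a, b} = l"
  proof (rule affine_dim_equal)
    show "affine hull {a, b} \<subseteq> l" using a b l(1) by (simp add: hull_minimal)
  qed (use l b in auto)
  then have "l = line_through a (b - a)" by (simp add: line_through_conv_affine_hull)
  then show "l \<in> {line_through x v | x v. v \<noteq> 0}"
    using b by (intro CollectI exI[of _ a] exI[of _ "b - a"]) simp
next
  fix l :: "'a set"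
  assume "l \<in> {line_through x v | x v. v \<noteq> 0}"
  then show "l \<in> affine_lines" by (auto simp: affine_lines_def line_through_conv_affine_hull)
qed

text \<open>The manifold of affine lines carries the quotient topology of the
  parametrization \<open>(x, v) \<mapsto> x + \<real> v\<close>, \<open>v \<noteq> 0\<close>.\<close>

definition line_topology :: "'a::euclidean_space set topology" where
  "line_topology = topology (\<lambda>W. W \<subseteq> affine_lines \<and>
     open {(x, v). v \<noteq> 0 \<and> line_through x v \<in> W})"

lemma openin_line_topology:
  "openin line_topology W \<longleftrightarrow>
     W \<subseteq> affine_lines \<and> open {(x, v). v \<noteq> 0 \<and> line_through x v \<in> W}"
proof -
  have "istopology (\<lambda>W :: 'a set set. W \<subseteq> affine_lines \<and>
     open {(x, v). v \<noteq> 0 \<and> line_through x v \<in> W})"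
    unfolding istopology_def
  proof (rule conjI; intro allI impI; (elim conjE)?)
    fix S T :: "'a set set"
    assume "S \<subseteq> affine_lines" "T \<subseteq> affine_lines"
      and *: "open {(x, v). v \<noteq> 0 \<and> line_through x v \<in> S}"
        "open {(x, v). v \<noteq> 0 \<and> line_through x v \<in> T}"
    have "{(x, v). v \<noteq> 0 \<and> line_through x v \<in> S \<inter> T} =
       {(x, v). v \<noteq> 0 \<and> line_through x v \<in> S} \<inter> {(x, v). v \<noteq> 0 \<and> line_through x v \<in> T}"
      by auto
    with open_Int[OF *] \<open>S \<subseteq> affine_lines\<close>
    show "S \<inter> T \<subseteq> affine_lines \<and> open {(x, v). v \<noteq> 0 \<and> line_through x v \<in> S \<inter> T}"
      by auto
  next
    fix K :: "'a set set set"
    assume K: "\<forall>S\<in>K. S \<subseteq> affine_lines \<and> open {(x, v). v \<noteq> 0 \<and> line_through x v \<in> S}"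
    have "{(x, v). v \<noteq> 0 \<and> line_through x v \<in> \<Union>K} =
       (\<Union>S\<in>K. {(x, v). v \<noteq> 0 \<and> line_through x v \<in> S})"
      by auto
    with K show "\<Union>K \<subseteq> affine_lines \<and> open {(x, v). v \<noteq> 0 \<and> line_through x v \<in> \<Union>K}"
      by (auto intro!: open_UN)
  qed
  then show ?thesis by (simp add: line_topology_def topology_inverse')
qed

lemma open_nonzero_direction: "open {(x :: 'a::euclidean_space, v :: 'a). v \<noteq> 0}"
proof -
  have "{(x :: 'a, v :: 'a). v \<noteq> 0} = UNIV \<times> (- {0})" by auto
  then show ?thesis by (simp add: open_Times open_Compl)
qed

lemma topspace_line_topology [simp]: "topspace line_topology = affine_lines"
proof (rule antisym)
  show "topspace line_topology \<subseteq> (affine_lines :: 'a set set)"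
    using openin_topspace[of line_topology] unfolding openin_line_topology by blast
  have "{(x :: 'a, v). v \<noteq> 0 \<and> line_through x v \<in> affine_lines} = {(x, v). v \<noteq> 0}"
    by (auto simp: affine_lines_eq)
  then have "openin line_topology (affine_lines :: 'a set set)"
    by (simp add: openin_line_topology open_nonzero_direction)
  then show "(affine_lines :: 'a set set) \<subseteq> topspace line_topology" by (rule openin_subset)
qed

lemma quotient_map_line_through:
  "quotient_map (top_of_set {(x :: 'a::euclidean_space, v). v \<noteq> 0}) line_topology
     (\<lambda>(x, v). line_through x v)"
proof -
  have eq: "{p \<in> {(x :: 'a, v). v \<noteq> 0}. (case p of (x, v) \<Rightarrow> line_through x v) \<in> W} =
     {(x, v). v \<noteq> 0 \<and> line_through x v \<in> W}" for W
    by auto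
  show ?thesis
    unfolding quotient_map_def topspace_line_topology topspace_euclidean_subtopology eq
    by (auto simp: openin_line_topology affine_lines_eq
        openin_open_eq[OF open_nonzero_direction])
qed

text \<open>One-dimensional Lebesgue measure on a line, transported by a unit-speed parametrization;
  \<open>line_length_eq\<close> shows that the choice of the parametrization does not matter.\<close>

definition line_length :: "'a::euclidean_space set \<Rightarrow> 'a set \<Rightarrow> ennreal" where
  "line_length l A =
     (let (x, v) = (SOME (x, v). norm v = 1 \<and> l = line_through x v)
      in emeasure lebesgue {t. x + t *\<^sub>R v \<in> A})"

lemma line_length_eq:
  assumes "norm v = 1"
  shows "line_length (line_through x v) A = emeasure lebesgue {t. x + t *\<^sub>R v \<in> A}"
proof -
  define p where "p = (SOME (y, w). norm w = 1 \<and> line_through x v = line_through y w)"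
  obtain y w where p: "p = (y, w)" by (cases p)
  have "case p of (y, w) \<Rightarrow> norm w = 1 \<and> line_through x v = line_through y w"
    unfolding p_def by (rule someI[of _ "(x, v)"]) (use assms in auto)
  then have w: "norm w = 1" and l: "line_through x v = line_through y w" by (auto simp: p)
  have "y \<in> line_through x v" unfolding l by (auto simp: line_through_def intro: image_eqI[of _ _ 0])
  then obtain a where a: "y = x + a *\<^sub>R v" by (auto simp: line_through_def)
  have "y + w \<in> line_through x v"
    unfolding l by (auto simp: line_through_def intro: image_eqI[of _ _ 1])
  then obtain b where b: "y + w = x + b *\<^sub>R v" by (auto simp: line_through_def)
  define c where "c = b - a"
  have c: "w = c *\<^sub>R v" using a b by (simp add: c_def algebra_simps)
  have c1: "\<bar>c\<bar> = 1" using w assms by (simp add: c)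
  then have cc: "c * c = 1" by (auto simp: abs_if split: if_splits)
  have yw: "y + t *\<^sub>R w = x + (c * t + a) *\<^sub>R v" for t
    by (simp add: a c algebra_simps)
  have "{t. x + t *\<^sub>R v \<in> A} = (\<lambda>t. c *\<^sub>R t + a) ` {t. y + t *\<^sub>R w \<in> A}"
  proof (intro set_eqI iffI)
    fix t assume t: "t \<in> {t. x + t *\<^sub>R v \<in> A}"
    have "c * (c * (t - a)) = (c * c) * (t - a)" by (simp only: mult.assoc)
    also have "\<dots> = t - a" unfolding cc by simp
    finally have "c * (c * (t - a)) + a = t" by linarith
    then show "t \<in> (\<lambda>t. c *\<^sub>R t + a) ` {t. y + t *\<^sub>R w \<in> A}"
      using t by (intro image_eqI[of _ _ "c * (t - a)"]) (simp_all add: yw)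
  qed (auto simp: yw)
  then have "emeasure lebesgue {t. x + t *\<^sub>R v \<in> A} = emeasure lebesgue {t. y + t *\<^sub>R w \<in> A}"
    by (simp only: emeasure_lebesgue_affine) (simp add: c1)
  then show ?thesis by (simp add: line_length_def p_def[symmetric] p)
qed

end

theory Submission
  imports Defs
begin

text \<open>Fix a unit vector \<open>e\<close>. The set \<open>U\<close> is the part of a large ball on which the coordinate
  \<open>x \<bullet> e\<close> lies in a fat Cantor set \<open>K \<subseteq> [0, 1]\<close>. A line that contains points of
  the ball on both sides of the slab \<open>0 \<le> x \<bullet> e \<le> 1\<close> meets \<open>U\<close> in an affine copy of
  the whole of \<open>K\<close>, so in positive length (\<open>line_length_slab\<close>). The lines that meet the two unit balls
  around \<open>-e\<close> and \<open>2e\<close> are of this kind, and they form an open set of lines.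

  The set \<open>K\<close> consists of the points \<open>x\<close> for which \<open>N\<^sub>k x\<close> keeps distance at least \<open>\<delta>\<^sub>k\<close> from the
  integers, for every \<open>k\<close>. The measure removed from \<open>[0, 1]\<close> at stage \<open>k\<close> is at most \<open>4 \<delta>\<^sub>k\<close>,
  independently of \<open>N\<^sub>k\<close>. Hence a small sum of the \<open>\<delta>\<^sub>k\<close> makes \<open>K\<close> fat, and the frequencies
  \<open>N\<^sub>k\<close> can still be chosen as large as desired.

  This freedom kills Fourier decay. The trigonometric polynomial
  \<open>T(y) = ((1 + cos 2\<pi>y) / 2)\<^sup>n\<close> has nonnegative Fourier coefficients of sum \<open>1\<close>, and its mean
  \<open>(2n choose n) / 4\<^sup>n\<close> decreases only polynomially in \<open>n\<close>, whereas its maximum on the points at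
  distance at least \<open>\<delta>\<^sub>k\<close> from the integers decreases exponentially. For suitable \<open>n = n\<^sub>k\<close> the
  mean exceeds this maximum by some \<open>\<eta>\<^sub>k > 0\<close>, which depends on \<open>\<delta>\<^sub>k\<close> only. Now let \<open>\<mu>\<close> be a measure
  on \<open>U\<close> of total mass \<open>m > 0\<close> whose transform is bounded by \<open>c |z| powr (- s / 2)\<close>, \<open>s > 0\<close>. The integral of
  \<open>T(N\<^sub>k (x \<bullet> e))\<close> is at most \<open>m\<close> times the maximum, because \<open>U\<close> avoids the peaks of \<open>T\<close>. By
  Fourier expansion it is also at least \<open>m\<close> times the mean minus \<open>c N\<^sub>k powr (- s / 2)\<close>, as only
  frequencies that are integer multiples of \<open>N\<^sub>k\<close> occur. So \<open>\<eta>\<^sub>k m \<le> c N\<^sub>k powr (- s / 2)\<close>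
  (\<open>cos_power_gap_le_decay\<close>), which fails for large \<open>k\<close> if \<open>N\<^sub>k\<close> grows so fast, compared with
  \<open>1 / \<eta>\<^sub>k\<close>, that it beats every power.\<close>

section \<open>Open sets of lines\<close>

text \<open>In the parametrization by a point and a direction, meeting an open set is a union over the
  line parameter of open conditions.\<close>

lemma openin_lines_meeting:
  fixes A :: "'a::euclidean_space set"
  assumes "open A"
  shows "openin line_topology {l \<in> affine_lines. l \<inter> A \<noteq> {}}"
proof -
  have "open {(x, v). x + t *\<^sub>R v \<in> A}" for t :: real
  proof -
    have "open ((\<lambda>p. fst p + t *\<^sub>R snd p) -` A)"
      by (intro continuous_open_vimage assms continuous_intros)
    then show ?thesis by (simp add: vimage_def case_prod_unfold)
  qed
  then have "open ({(x, v). v \<noteq> 0} \<inter> (\<Union>t. {(x, v). x + t *\<^sub>R v \<in> A}))"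
    by (intro open_Int open_nonzero_direction open_UN) auto
  also have "{(x, v). v \<noteq> 0} \<inter> (\<Union>t. {(x, v). x + t *\<^sub>R v \<in> A}) =
      {(x, v). v \<noteq> 0 \<and> line_through x v \<in> {l \<in> affine_lines. l \<inter> A \<noteq> {}}}"
    by (auto simp: affine_lines_eq line_through_def)
  finally show ?thesis by (auto simp: openin_line_topology)
qed

lemma line_through_two_points:
  assumes "l \<in> affine_lines" "p \<in> l" "q \<in> l" "p \<noteq> q"
  shows "l = line_through p ((1 / norm (q - p)) *\<^sub>R (q - p))"
proof -
  from assms(1) obtain x v where l: "l = line_through x v" "v \<noteq> 0"
    by (auto simp: affine_lines_eq)
  obtain a b where a: "p = x + a *\<^sub>R v" and b: "q = x + b *\<^sub>R v"
    using assms(2,3) l by (auto simp: line_through_def)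
  define r where "r = (1 / norm (q - p)) * (b - a)"
  have "a \<noteq> b" using assms(4) a b by auto
  then have r: "r \<noteq> 0" using assms(4) by (simp add: r_def)
  have v: "(1 / norm (q - p)) *\<^sub>R (q - p) = r *\<^sub>R v"
    unfolding r_def scaleR_scaleR[symmetric]
    by (rule arg_cong[where f = "scaleR _"]) (simp add: a b algebra_simps)
  have "x + t *\<^sub>R v = p + ((t - a) / r) *\<^sub>R (r *\<^sub>R v)" for t
    using r by (simp add: a scaleR_left_diff_distrib)
  moreover have "p + t *\<^sub>R (r *\<^sub>R v) = x + (a + t * r) *\<^sub>R v" for t
    by (simp add: a algebra_simps)
  ultimately show ?thesis unfolding l v line_through_def
    by (metis (no_types, lifting) rangeI subset_antisym image_subsetI)
qed

text \<open>On the part of the line where \<open>x \<bullet> e\<close> lies between \<open>0\<close> and \<open>1\<close> one is on the segment from \<open>p\<close>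
  to \<open>q\<close>, hence in \<open>C\<close>. So the section is all of the preimage of \<open>K\<close> under an affine map of
  slope \<open>w \<bullet> e\<close>, where \<open>w\<close> is the direction of the line, and its length is that of \<open>K\<close> divided
  by \<open>w \<bullet> e\<close>.\<close>

lemma line_length_slab:
  fixes e :: "'a::euclidean_space"
  assumes l: "l \<in> affine_lines" "p \<in> l" "q \<in> l"
    and pq: "p \<bullet> e < 0" "1 < q \<bullet> e"
    and C: "convex C" "p \<in> C" "q \<in> C"
    and K: "K \<subseteq> {0..1}" "emeasure lebesgue K > 0"
  shows "line_length l ({x \<in> C. x \<bullet> e \<in> K} \<inter> l) > 0"
proof -
  have ne: "p \<noteq> q" using pq by auto
  define w where "w = (1 / norm (q - p)) *\<^sub>R (q - p)"
  have w: "norm w = 1" using ne by (simp add: w_def)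
  have lw: "l = line_through p w" unfolding w_def by (rule line_through_two_points[OF l ne])
  have we: "w \<bullet> e > 0" unfolding w_def using pq ne by (simp add: inner_diff_left)
  have mem: "p + t *\<^sub>R w \<in> {x \<in> C. x \<bullet> e \<in> K} \<inter> l \<longleftrightarrow> p \<bullet> e + t * (w \<bullet> e) \<in> K" for t
  proof -
    have "p + t *\<^sub>R w \<in> C" if "p \<bullet> e + t * (w \<bullet> e) \<in> K"
    proof -
      \<comment> \<open>The position of the point relative to the segment: \<open>u = 0\<close> at \<open>p\<close>, \<open>u = 1\<close> at \<open>q\<close>.\<close>
      define u where "u = t / norm (q - p)"
      have *: "0 \<le> p \<bullet> e + t * (w \<bullet> e)" "p \<bullet> e + t * (w \<bullet> e) \<le> 1" using that K(1) by auto
      have tu: "t * (w \<bullet> e) = u * (q \<bullet> e - p \<bullet> e)"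
        by (simp add: w_def u_def inner_diff_left)
      have "0 < u * (q \<bullet> e - p \<bullet> e)" "u * (q \<bullet> e - p \<bullet> e) < 1 * (q \<bullet> e - p \<bullet> e)"
        using * pq unfolding tu mult_1 by linarith+
      then have "0 \<le> u" "u \<le> 1" using pq
        by (simp_all add: zero_less_mult_iff mult_less_cancel_right)
      then have "(1 - u) *\<^sub>R p + u *\<^sub>R q \<in> C" using C by (simp add: convexD)
      moreover have "(1 - u) *\<^sub>R p + u *\<^sub>R q = p + t *\<^sub>R w"
        by (simp add: w_def u_def algebra_simps)
      ultimately show ?thesis by simp
    qed
    then show ?thesis by (auto simp: lw line_through_def inner_add_left)
  qed
  have "K = (\<lambda>t. (w \<bullet> e) *\<^sub>R t + p \<bullet> e) ` {t. p \<bullet> e + t * (w \<bullet> e) \<in> K}"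
  proof (intro set_eqI iffI)
    fix y assume "y \<in> K"
    then show "y \<in> (\<lambda>t. (w \<bullet> e) *\<^sub>R t + p \<bullet> e) ` {t. p \<bullet> e + t * (w \<bullet> e) \<in> K}"
      using we by (intro image_eqI[of _ _ "(y - p \<bullet> e) / (w \<bullet> e)"]) simp_all
  qed (auto simp: algebra_simps)
  then have "emeasure lebesgue K =
      emeasure lebesgue ((\<lambda>t. (w \<bullet> e) *\<^sub>R t + p \<bullet> e) ` {t. p \<bullet> e + t * (w \<bullet> e) \<in> K})"
    by simp
  also have "\<dots> = ennreal \<bar>w \<bullet> e\<bar> * emeasure lebesgue {t. p \<bullet> e + t * (w \<bullet> e) \<in> K}"
    by (subst emeasure_lebesgue_affine) simp
  finally have "emeasure lebesgue {t. p \<bullet> e + t * (w \<bullet> e) \<in> K} > 0"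
    using K(2) by (auto simp: zero_less_iff_neq_zero)
  then show ?thesis unfolding lw line_length_eq[OF w] using mem by (simp add: lw)
qed


section \<open>Avoiding neighbourhoods of the rationals with given denominators\<close>

definition avoiding_set :: "(nat \<Rightarrow> nat) \<Rightarrow> (nat \<Rightarrow> real) \<Rightarrow> real set" where
  "avoiding_set N \<delta> = {x \<in> {0..1}. \<forall>k. \<forall>m::int. \<delta> k \<le> \<bar>real (N k) * x - of_int m\<bar>}"

lemma closed_avoiding_set: "closed (avoiding_set N \<delta>)"
proof -
  have "avoiding_set N \<delta> =
      {0..1} \<inter> (\<Inter>k. \<Inter>m::int. {x. \<delta> k \<le> \<bar>real (N k) * x - of_int m\<bar>})"
    by (auto simp: avoiding_set_def)
  then show ?thesis
    by (simp add: closed_INT closed_Int closed_Collect_le continuous_intros)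
qed

text \<open>Within \<open>[0, 1]\<close>, stage \<open>k\<close> removes at most \<open>N k + 1\<close> intervals of length \<open>2 \<delta> k / N k\<close>, so
  at most \<open>4 \<delta> k\<close> in total. The frequencies cancel, which leaves them free to be chosen later.\<close>

lemma emeasure_avoiding_set_pos:
  assumes N: "\<And>k. N k \<ge> 1" and \<delta>: "\<And>k. \<delta> k \<ge> 0" "summable \<delta>" "(\<Sum>k. \<delta> k) < 1 / 4"
  shows "emeasure lebesgue (avoiding_set N \<delta>) > 0"
proof -
  define K where "K = avoiding_set N \<delta>"
  define B where "B k = (\<Union>m\<in>{0..int (N k)}. ball (of_int m / real (N k)) (\<delta> k / real (N k)))" for k
  have K_meas: "K \<in> sets lborel" unfolding K_def using closed_avoiding_set by simp
  have B_meas: "B k \<in> sets lborel" for k unfolding B_def by (simp add: open_UN borel_open)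
  have \<delta>1: "\<delta> k < 1" for k
    using sum_le_suminf[OF \<delta>(2), of "{k}"] \<delta> by simp
  have cover: "{0..1} \<subseteq> K \<union> (\<Union>k. B k)"
  proof
    fix x :: real assume x: "x \<in> {0..1}"
    show "x \<in> K \<union> (\<Union>k. B k)"
    proof (cases "x \<in> K")
      case False
      then obtain k and m :: int where km: "\<bar>real (N k) * x - of_int m\<bar> < \<delta> k"
        using x by (auto simp: K_def avoiding_set_def not_le)
      have Nk: "real (N k) \<ge> 1" using N[of k] by simp
      have "0 \<le> real (N k) * x" "real (N k) * x \<le> real (N k)"
        using x Nk by (auto simp: mult_left_le)
      \<comment> \<open>Both end points \<open>0\<close> and \<open>N k\<close> count, since half of their intervals lies in \<open>[0, 1]\<close>.\<close>
      then have "-1 < real_of_int m" "real_of_int m < real (N k) + 1"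
        using km \<delta>1[of k] by linarith+
      then have m: "m \<in> {0..int (N k)}" by auto
      have "\<bar>of_int m / real (N k) - x\<bar> = \<bar>real (N k) * x - of_int m\<bar> / real (N k)"
        using Nk by (simp add: abs_if field_simps)
      also have "\<dots> < \<delta> k / real (N k)" using km Nk by (intro divide_strict_right_mono) auto
      finally have "x \<in> B k" using m unfolding B_def
        by (auto simp: dist_real_def)
      then show ?thesis by blast
    qed simp
  qed
  have B_small: "emeasure lborel (B k) \<le> ennreal (4 * \<delta> k)" for k
  proof -
    have Nk: "real (N k) \<ge> 1" using N[of k] by simp
    have "emeasure lborel (B k) \<le>
        (\<Sum>m\<in>{0..int (N k)}. emeasure lborel (ball (of_int m / real (N k)) (\<delta> k / real (N k))))"
      unfolding B_def by (intro emeasure_subadditive_finite) auto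
    also have "\<dots> = (\<Sum>m\<in>{0..int (N k)}. ennreal (2 * \<delta> k / real (N k)))"
      using Nk \<delta>(1)[of k] by (intro sum.cong) (auto simp: ball_eq_greaterThanLessThan)
    also have "\<dots> = ennreal (\<Sum>m\<in>{0..int (N k)}. 2 * \<delta> k / real (N k))"
      using \<delta>(1)[of k] by (intro sum_ennreal) auto
    also have "\<dots> \<le> ennreal (4 * \<delta> k)"
    proof (rule ennreal_leI)
      have "(\<Sum>m\<in>{0..int (N k)}. 2 * \<delta> k / real (N k)) = 2 * \<delta> k * ((real (N k) + 1) / real (N k))"
        by (simp add: algebra_simps)
      also have "\<dots> \<le> 2 * \<delta> k * 2"
        using Nk \<delta>(1)[of k] by (intro mult_left_mono) (auto simp: field_simps)
      finally show "(\<Sum>m\<in>{0..int (N k)}. 2 * \<delta> k / real (N k)) \<le> 4 * \<delta> k" by simp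
    qed
    finally show ?thesis .
  qed
  have "emeasure lborel (\<Union>k. B k) \<le> (\<Sum>k. emeasure lborel (B k))"
    using B_meas by (intro emeasure_subadditive_countably) auto
  also have "\<dots> \<le> (\<Sum>k. ennreal (4 * \<delta> k))" by (intro suminf_le B_small) auto
  also have "\<dots> = ennreal (\<Sum>k. 4 * \<delta> k)"
    using \<delta> by (intro suminf_ennreal2) (auto simp: summable_mult)
  also have "\<dots> < 1"
    using \<delta> by (simp add: suminf_mult)
  finally have U: "emeasure lborel (\<Union>k. B k) < 1" .
  have "1 = emeasure lborel {0..1::real}" by simp
  also have "\<dots> \<le> emeasure lborel (K \<union> (\<Union>k. B k))"
    using K_meas B_meas by (intro emeasure_mono cover) auto
  also have "\<dots> \<le> emeasure lborel K + emeasure lborel (\<Union>k. B k)"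
    using K_meas B_meas by (intro emeasure_subadditive) auto
  finally have "emeasure lborel K \<noteq> 0" using U by auto
  then show ?thesis using K_meas
    by (simp add: K_def zero_less_iff_neq_zero)
qed

lemma cos_le_if_away_from_integers:
  assumes "0 \<le> \<delta>" "\<And>m::int. \<delta> \<le> \<bar>y - of_int m\<bar>"
  shows "cos (2 * pi * y) \<le> cos (2 * pi * \<delta>)"
proof -
  define r where "r = \<bar>y - of_int (round y)\<bar>"
  have r: "\<delta> \<le> r" "r \<le> 1 / 2"
    using assms(2) of_int_round_abs_le[of y] by (auto simp: r_def abs_minus_commute)
  have "cos (2 * pi * y) = cos (2 * pi * (y - of_int (round y)))"
    using cos_int_2pin[of "round y"] sin_int_2pin[of "round y"]
    by (simp add: right_diff_distrib cos_diff mult.assoc)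
  also have "\<dots> = cos (2 * pi * r)"
    by (auto simp: r_def abs_if right_diff_distrib cos_diff)
  also have "\<dots> \<le> cos (2 * pi * \<delta>)"
    using assms(1) r by (intro cos_monotone_0_pi_le) auto
  finally show ?thesis .
qed


section \<open>Trigonometric polynomials concentrated near the integers\<close>

lemma half_one_plus_cos_nonneg: "0 \<le> (1 + cos t) / 2" for t :: real
proof -
  have "0 \<le> 1 + cos t" using cos_ge_minus_one[of t] by linarith
  then show ?thesis by simp
qed

lemma half_one_plus_cos_le_1: "(1 + cos t) / 2 \<le> 1" for t :: real
  by (simp add: divide_le_eq)

text \<open>The left-hand side is \<open>cos (t / 2) ^ (2 * n)\<close>. Expanding the cosine into exponentials by the
  binomial theorem gives nonnegative coefficients and the mean \<open>(2 * n choose n) / 4 ^ n\<close>, the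
  coefficient for \<open>j = n\<close>.\<close>

lemma cos_power_expansion:
  "complex_of_real (((1 + cos t) / 2) ^ n) =
     (\<Sum>j\<le>2 * n. of_real (real (2 * n choose j) / 4 ^ n) * cis ((real n - real j) * t))"
proof -
  have "(1 + cos t) / 2 = cos (t / 2) ^ 2"
    using cos_double_cos[of "t / 2"] by (simp add: field_simps)
  then have "of_real (((1 + cos t) / 2) ^ n) = complex_of_real ((2 * cos (t / 2)) ^ (2 * n) / 4 ^ n)"
    by (simp add: power_mult power_mult_distrib)
  also have "\<dots> = (cis (- t / 2) + cis (t / 2)) ^ (2 * n) / 4 ^ n"
  proof -
    have "cis (- t / 2) + cis (t / 2) = complex_of_real (2 * cos (t / 2))"
      by (simp add: complex_eq_iff)
    then show ?thesis by simp
  qed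
  also have "\<dots> = (\<Sum>j\<le>2 * n. of_nat (2 * n choose j) * cis (- t / 2) ^ j * cis (t / 2) ^ (2 * n - j)) / 4 ^ n"
    by (simp only: binomial_ring)
  also have "\<dots> = (\<Sum>j\<le>2 * n. of_real (real (2 * n choose j) / 4 ^ n) * cis ((real n - real j) * t))"
    unfolding sum_divide_distrib
  proof (intro sum.cong refl)
    fix j assume "j \<in> {..2 * n}"
    then have j: "real (2 * n - j) = 2 * real n - real j" by auto
    have "cis (- t / 2) ^ j * cis (t / 2) ^ (2 * n - j) = cis ((real n - real j) * t)"
      unfolding Complex.DeMoivre cis_mult
      by (rule arg_cong[where f = cis], simp only: j, simp add: field_simps)
    then show "of_nat (2 * n choose j) * cis (- t / 2) ^ j * cis (t / 2) ^ (2 * n - j) / 4 ^ n =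
        of_real (real (2 * n choose j) / 4 ^ n) * cis ((real n - real j) * t)"
      by (simp add: mult.assoc)
  qed
  finally show ?thesis .
qed

text \<open>The central binomial coefficient is at least \<open>4 ^ n / (2 * n)\<close>, so the right-hand side decays
  no faster than \<open>1 / (2 * n)\<close>.\<close>

lemma ex_cos_power_gap:
  fixes q :: real
  assumes "0 \<le> q" "q < 1"
  shows "\<exists>n. q ^ n < real (2 * n choose n) / 4 ^ n"
proof -
  have "(\<lambda>n. real n * q ^ n) \<longlonglongrightarrow> 0"
    using assms by (intro powser_times_n_limit_0) auto
  then have "eventually (\<lambda>n. real n * q ^ n < 1 / 2) sequentially"
    by (rule order_tendstoD) simp
  then have "eventually (\<lambda>n. n > 0 \<and> real n * q ^ n < 1 / 2) sequentially"
    by (intro eventually_conj eventually_gt_at_top)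
  then obtain n where n: "n > 0" "real n * q ^ n < 1 / 2"
    using eventually_happens'[OF sequentially_bot] by blast
  have "q ^ n < 1 / (2 * real n)" using n by (simp add: field_simps)
  also have "\<dots> \<le> real (2 * n choose n) / 4 ^ n"
    using central_binomial_lower_bound[OF n(1)] n(1) by (simp add: field_simps)
  finally show ?thesis by blast
qed


section \<open>Fourier decay\<close>

text \<open>By the Lindeloef property, countably many open null sets cover the complement of the support.\<close>

lemma AE_in_superset_of_support:
  assumes "sets M = sets borel" "measure_support M \<subseteq> X"
  shows "AE x in M. x \<in> X"
proof -
  define F where "F = {V. open V \<and> emeasure M V = 0}"
  obtain G where G: "G \<subseteq> F" "countable G" "\<Union>G = \<Union>F"
    using Lindelof[of F] by (auto simp: F_def)
  have "\<Union>G \<in> null_sets M"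
    using G(1,2) assms(1)
    by (intro null_sets_UN'[of G "\<lambda>x. x", simplified]) (auto simp: F_def null_sets_def)
  moreover have "- X \<subseteq> \<Union>G"
    using assms(2) unfolding G(3) F_def measure_support_def by (auto simp: zero_less_iff_neq_zero)
  ultimately show ?thesis by (intro AE_I'[of "\<Union>G"]) auto
qed

lemma integral_cos_power:
  fixes e :: "'a::euclidean_space"
  assumes "finite_measure M" and "sets M = sets borel"
  shows "of_real (\<integral>x. ((1 + cos (2 * pi * (N * (x \<bullet> e)))) / 2) ^ n \<partial>M) =
    (\<Sum>j\<le>2 * n. of_real (real (2 * n choose j) / 4 ^ n) *
       fourier_transform M (((real j - real n) * N) *\<^sub>R e))"
proof -
  interpret finite_measure M by fact
  have exp_cis: "exp (- 2 * of_real pi * \<i> * of_real ((((real j - real n) * N) *\<^sub>R e) \<bullet> x)) =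
      cis ((real n - real j) * (2 * pi * (N * (x \<bullet> e))))" for j x
    unfolding cis_conv_exp by (simp add: inner_commute algebra_simps)
  have meas: "(\<lambda>x. cis (a * (2 * pi * (N * (x \<bullet> e))))) \<in> borel_measurable M" for a
    unfolding measurable_cong_sets[OF assms(2) refl]
    by (intro borel_measurable_continuous_onI continuous_intros)
  have int: "integrable M (\<lambda>x. cis (a * (2 * pi * (N * (x \<bullet> e)))))" for a
    by (rule integrable_const_bound[where B = 1, OF _ meas]) simp
  have "of_real (\<integral>x. ((1 + cos (2 * pi * (N * (x \<bullet> e)))) / 2) ^ n \<partial>M) =
      (\<integral>x. complex_of_real (((1 + cos (2 * pi * (N * (x \<bullet> e)))) / 2) ^ n) \<partial>M)"
    by (rule integral_complex_of_real[symmetric])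
  also have "\<dots> = (\<Sum>j\<le>2 * n. of_real (real (2 * n choose j) / 4 ^ n) *
      (\<integral>x. cis ((real n - real j) * (2 * pi * (N * (x \<bullet> e)))) \<partial>M))"
    unfolding cos_power_expansion
    by (subst Bochner_Integration.integral_sum) (auto intro!: int)
  finally show ?thesis unfolding fourier_transform_def exp_cis .
qed

text \<open>This is where decay meets avoidance: the integral of the trigonometric polynomial at frequency
  \<open>N\<close> is at most \<open>q ^ n\<close> times the total mass by \<open>away\<close>, and its Fourier expansion equals the mean
  times the total mass up to an error controlled by \<open>decay\<close>. Every other frequency in the
  expansion has norm at least \<open>N\<close>, and the coefficients add up to \<open>1\<close>, so the degree \<open>n\<close>
  does not enter the bound on the error.\<close>

lemma cos_power_gap_le_decay:
  fixes e :: "'a::euclidean_space"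
  assumes fin: "finite_measure M" and sets: "sets M = sets borel"
    and e: "norm e = 1" and N: "N > 0" and c: "c \<ge> 0" and s: "s \<ge> 0"
    and decay: "\<And>z. z \<noteq> 0 \<Longrightarrow> norm (fourier_transform M z) \<le> c * norm z powr (- s / 2)"
    and away: "AE x in M. (1 + cos (2 * pi * (N * (x \<bullet> e)))) / 2 \<le> q"
  shows "(real (2 * n choose n) / 4 ^ n - q ^ n) * measure M (space M) \<le> c * N powr (- s / 2)"
proof -
  interpret finite_measure M by fact
  define T where "T x = ((1 + cos (2 * pi * (N * (x \<bullet> e)))) / 2) ^ n" for x
  define a where "a j = real (2 * n choose j) / 4 ^ n" for j
  define I where "I = (\<integral>x. T x \<partial>M)"
  define F where "F j = fourier_transform M (((real j - real n) * N) *\<^sub>R e)" for j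
  define m where "m = measure M (space M)"
  note base = half_one_plus_cos_nonneg half_one_plus_cos_le_1
  have Tm: "T \<in> borel_measurable M"
    unfolding T_def measurable_cong_sets[OF sets refl]
    by (intro borel_measurable_continuous_onI continuous_intros) auto
  have intT: "integrable M T"
  proof (rule integrable_const_bound[OF _ Tm])
    show "AE x in M. norm (T x) \<le> 1"
      by (simp only: T_def real_norm_def power_abs abs_of_nonneg[OF base(1)])
        (intro AE_I2 power_le_one base)
  qed
  have "I \<le> (\<integral>x. q ^ n \<partial>M)" unfolding I_def
  proof (rule integral_mono_AE[OF intT])
    show "AE x in M. T x \<le> q ^ n"
      using away by eventually_elim (auto simp: T_def intro!: power_mono base)
  qed simp
  then have upper: "I \<le> q ^ n * m" by (simp add: m_def mult.commute)
  have F0: "F n = of_real m"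
    by (simp add: F_def fourier_transform_def m_def scaleR_conv_of_real)
  have Fj: "norm (F j) \<le> c * N powr (- s / 2)" if "j \<noteq> n" for j
  proof -
    have *: "norm (((real j - real n) * N) *\<^sub>R e) = \<bar>real j - real n\<bar> * N"
      using e N by (simp add: abs_mult)
    have "((real j - real n) * N) *\<^sub>R e \<noteq> 0" using that e N by auto
    from decay[OF this] have "norm (F j) \<le> c * (\<bar>real j - real n\<bar> * N) powr (- s / 2)"
      unfolding F_def * .
    also have "\<dots> \<le> c * N powr (- s / 2)"
    proof (intro mult_left_mono powr_mono2' c)
      have "1 \<le> \<bar>real j - real n\<bar>" using that by linarith
      then show "N \<le> \<bar>real j - real n\<bar> * N" using N by simp
    qed (use s N in auto)
    finally show ?thesis .
  qed
  have sum_a: "(\<Sum>j\<le>2 * n. a j) = 1"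
    unfolding a_def sum_divide_distrib[symmetric] of_nat_sum[symmetric] choose_row_sum
    by (simp add: power_mult)
  have "of_real I = (\<Sum>j\<le>2 * n. of_real (a j) * F j)"
    unfolding I_def T_def a_def F_def by (rule integral_cos_power[OF fin sets])
  also have "\<dots> = of_real (a n * m) + (\<Sum>j\<in>{..2 * n} - {n}. of_real (a j) * F j)"
    by (subst sum.remove[of _ n]) (auto simp: F0)
  finally have "of_real (a n * m - I) = - (\<Sum>j\<in>{..2 * n} - {n}. of_real (a j) * F j)"
    by simp
  then have "norm (complex_of_real (a n * m - I)) = norm (\<Sum>j\<in>{..2 * n} - {n}. of_real (a j) * F j)"
    by (simp only: norm_minus_cancel)
  also have "\<dots> \<le> (\<Sum>j\<in>{..2 * n} - {n}. a j * (c * N powr (- s / 2)))"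
  proof (intro sum_norm_le)
    fix j assume j: "j \<in> {..2 * n} - {n}"
    have "0 \<le> a j" by (simp add: a_def)
    then show "norm (complex_of_real (a j) * F j) \<le> a j * (c * N powr (- s / 2))"
      unfolding norm_mult norm_of_real using j by (simp only: abs_of_nonneg) (intro mult_left_mono Fj, auto)
  qed
  also have "\<dots> \<le> (\<Sum>j\<le>2 * n. a j * (c * N powr (- s / 2)))"
    by (intro sum_mono2) (auto simp: a_def c)
  also have "\<dots> = c * N powr (- s / 2)"
    by (simp only: sum_distrib_right[symmetric] sum_a mult_1)
  finally have "a n * m - I \<le> c * N powr (- s / 2)" by (simp only: norm_of_real)
  with upper show ?thesis by (simp add: a_def m_def left_diff_distrib)
qed

lemma fourier_dim_eq_0_if_no_decay:
  fixes X :: "'a::euclidean_space set"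
  assumes "\<And>M :: 'a measure. \<And>s c. \<lbrakk>nonzero_finite_borel_measure M; measure_support M \<subseteq> X; s > 0; c > 0;
      \<And>z. z \<noteq> 0 \<Longrightarrow> norm (fourier_transform M z) \<le> c * norm z powr (- s / 2)\<rbrakk> \<Longrightarrow> False"
  shows "fourier_dim X = 0"
proof -
  have "fourier_dim_measure M = 0"
    if M: "nonzero_finite_borel_measure M" "measure_support M \<subseteq> X" for M :: "'a measure"
  proof -
    have "\<not> s > 0" if "\<exists>c>0. \<forall>z. z \<noteq> 0 \<longrightarrow>
        norm (fourier_transform M z) \<le> c * norm z powr (- s / 2)" for s
      using assms[OF M] that by blast
    then have "fourier_dim_measure M \<le> 0"
      unfolding fourier_dim_measure_def by (intro Sup_least) (fastforce simp: not_less)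
    then show ?thesis by simp
  qed
  then have "fourier_dim X \<le> 0"
    unfolding fourier_dim_def by (intro Sup_least) auto
  then show ?thesis by simp
qed

text \<open>The exponent \<open>Suc k\<close> in the growth condition handles all decay rates \<open>s\<close> at once: as soon as
  \<open>Suc k * s / 2 \<ge> 1\<close>, the factor \<open>N k powr (- s / 2)\<close> is at most \<open>\<eta> k / Suc k\<close>. The bound
  \<open>\<eta> k * m \<le> c * N k powr (- s / 2)\<close> for the total mass \<open>m\<close> then becomes \<open>m * Suc k \<le> c\<close>,
  which is impossible for large \<open>k\<close>.\<close>

lemma fourier_dim_eq_0_if_frequencies_grow:
  fixes e :: "'a::euclidean_space"
  assumes e: "norm e = 1" and N: "\<And>k. N k \<ge> 1" and \<delta>: "\<And>k. \<delta> k \<ge> 0"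
    and gap_pos: "\<And>k. \<eta> k > 0"
    and gap: "\<And>k. \<eta> k \<le> real (2 * n k choose n k) / 4 ^ n k - ((1 + cos (2 * pi * \<delta> k)) / 2) ^ n k"
    and large: "\<And>k. (real (Suc k) / \<eta> k) ^ Suc k \<le> real (N k)"
    and X: "X \<subseteq> {x. x \<bullet> e \<in> avoiding_set N \<delta>}"
  shows "fourier_dim X = 0"
proof (rule fourier_dim_eq_0_if_no_decay)
  fix M :: "'a measure" and s c :: real
  assume M: "nonzero_finite_borel_measure M" and supp: "measure_support M \<subseteq> X"
    and s: "s > 0" and c: "c > 0"
    and decay: "\<And>z. z \<noteq> 0 \<Longrightarrow> norm (fourier_transform M z) \<le> c * norm z powr (- s / 2)"
  have fin: "finite_measure M" and sets: "sets M = sets borel"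
    using M by (auto simp: nonzero_finite_borel_measure_def)
  interpret finite_measure M by fact
  define m where "m = measure M (space M)"
  have m: "m > 0"
    using M by (simp add: m_def nonzero_finite_borel_measure_def emeasure_eq_measure zero_less_measure_iff)
  have bound: "m * real (Suc k) \<le> c" if k: "2 / s \<le> real (Suc k)" for k
  proof -
    have AE: "AE x in M. (1 + cos (2 * pi * (real (N k) * (x \<bullet> e)))) / 2 \<le> (1 + cos (2 * pi * \<delta> k)) / 2"
      using AE_in_superset_of_support[OF sets supp]
    proof eventually_elim
      case (elim x)
      then have "\<delta> k \<le> \<bar>real (N k) * (x \<bullet> e) - of_int i\<bar>" for i
        using X by (auto simp: avoiding_set_def)
      from cos_le_if_away_from_integers[OF \<delta> this] show ?case by simp
    qed
    have "\<eta> k * m \<le>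
        (real (2 * n k choose n k) / 4 ^ n k - ((1 + cos (2 * pi * \<delta> k)) / 2) ^ n k) * m"
      using gap m by (intro mult_right_mono) auto
    also have "\<dots> \<le> c * real (N k) powr (- s / 2)"
      unfolding m_def using N[of k] c s
      by (intro cos_power_gap_le_decay[OF fin sets e _ _ _ decay AE]) auto
    also have "\<dots> \<le> c * (\<eta> k / real (Suc k))"
    proof (intro mult_left_mono)
      define b where "b = real (Suc k) / \<eta> k"
      have "2 * n k choose n k \<le> 2 ^ (2 * n k)"
        unfolding choose_row_sum[symmetric] by (intro member_le_sum) auto
      then have "real (2 * n k choose n k) / 4 ^ n k \<le> 1"
        using of_nat_mono[where 'a = real] by (fastforce simp: power_mult)
      moreover have "0 \<le> ((1 + cos (2 * pi * \<delta> k)) / 2) ^ n k"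
        by (intro zero_le_power half_one_plus_cos_nonneg)
      ultimately have "\<eta> k \<le> 1" using gap[of k] by linarith
      then have b: "b \<ge> 1" using gap_pos[of k] by (simp add: b_def field_simps)
      have "real (N k) powr (- s / 2) \<le> (b ^ Suc k) powr (- s / 2)"
        using large[of k] b s by (intro powr_mono2') (auto simp: b_def simp del: power_Suc)
      also have "\<dots> = b powr (real (Suc k) * (- s / 2))"
        using b by (simp add: powr_powr powr_realpow[symmetric] del: power_Suc of_nat_Suc)
      also have "\<dots> \<le> b powr (- 1)"
        using b k s by (intro powr_mono) (auto simp: field_simps)
      also have "\<dots> = \<eta> k / real (Suc k)"
        using b gap_pos[of k] by (simp add: powr_minus b_def)
      finally show "real (N k) powr (- s / 2) \<le> \<eta> k / real (Suc k)" .
    qed (use c in auto)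
    finally have "\<eta> k * (m * real (Suc k)) \<le> \<eta> k * c"
      by (simp add: field_simps del: of_nat_Suc)
    then show ?thesis using gap_pos[of k] by (simp only: mult_le_cancel_left_pos)
  qed
  obtain k where k: "max (2 / s) (c / m + 1) \<le> real k" using real_arch_simple by blast
  then have "m * real (Suc k) \<le> c" by (intro bound) auto
  moreover have "c / m < real (Suc k)" using k by auto
  ultimately show False using m by (simp add: field_simps)
qed


text \<open>The gaps \<open>\<eta> k\<close> depend on \<open>\<delta> k\<close> only, so the frequencies can be chosen after them.\<close>

lemma ex_frequencies_fourier_dim_eq_0:
  fixes e :: "'a::euclidean_space"
  assumes e: "norm e = 1" and \<delta>: "\<And>k. 0 < \<delta> k" "\<And>k. \<delta> k \<le> 1 / 2"
  obtains N where "\<And>k. N k \<ge> 1"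
    and "\<And>X :: 'a set. X \<subseteq> {x. x \<bullet> e \<in> avoiding_set N \<delta>} \<Longrightarrow> fourier_dim X = 0"
proof -
  have "\<exists>n. ((1 + cos (2 * pi * \<delta> k)) / 2) ^ n < real (2 * n choose n) / 4 ^ n" for k
  proof (rule ex_cos_power_gap)
    show "0 \<le> (1 + cos (2 * pi * \<delta> k)) / 2" by (rule half_one_plus_cos_nonneg)
    have "cos (2 * pi * \<delta> k) < cos 0"
      using \<delta>[of k] by (intro cos_monotone_0_pi) auto
    then show "(1 + cos (2 * pi * \<delta> k)) / 2 < 1" by simp
  qed
  then obtain n where n:
    "\<And>k. ((1 + cos (2 * pi * \<delta> k)) / 2) ^ n k < real (2 * n k choose n k) / 4 ^ n k"
    by metis
  define \<eta> where
    "\<eta> k = real (2 * n k choose n k) / 4 ^ n k - ((1 + cos (2 * pi * \<delta> k)) / 2) ^ n k" for k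
  have "\<exists>N\<ge>1. (real (Suc k) / \<eta> k) ^ Suc k \<le> real N" for k
  proof -
    obtain N where "(real (Suc k) / \<eta> k) ^ Suc k \<le> real N" using real_arch_simple by blast
    then show ?thesis by (intro exI[of _ "Suc N"]) simp
  qed
  then obtain N where N: "\<And>k. N k \<ge> 1" "\<And>k. (real (Suc k) / \<eta> k) ^ Suc k \<le> real (N k)"
    by metis
  have "fourier_dim X = 0" if "X \<subseteq> {x. x \<bullet> e \<in> avoiding_set N \<delta>}" for X :: "'a set"
    by (rule fourier_dim_eq_0_if_frequencies_grow[where n = n and \<eta> = \<eta>, OF e N(1) _ _ _ N(2) that])
      (use n \<delta>(1) in \<open>auto simp: \<eta>_def intro: less_imp_le\<close>)
  with N(1) show thesis by (rule that)
qed


section \<open>A compact set of Fourier dimension zero with long line sections\<close>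

theorem proposition7p2:
  assumes "CARD('n::finite) \<ge> 2"
  shows "\<exists>U :: (real ^ 'n) set. compact U \<and>
    (\<exists>L. L \<subseteq> affine_lines \<and> line_topology interior_of L \<noteq> {} \<and>
      (\<forall>l\<in>L. line_length l (U \<inter> l) > 0)) \<and>
    fourier_dim U = 0"
proof -
  define \<delta> :: "nat \<Rightarrow> real" where "\<delta> k = (1 / 2) ^ k / 16" for k
  have \<delta>_pos: "\<delta> k > 0" for k by (simp add: \<delta>_def)
  have \<delta>_le: "\<delta> k \<le> 1 / 2" for k
    using power_le_one[of "1 / 2 :: real" k] by (simp add: \<delta>_def)
  have \<delta>_sums: "\<delta> sums (2 / 16)"
    unfolding \<delta>_def using geometric_sums[of "1 / 2 :: real"] by (intro sums_divide) simp
  define e :: "real ^ 'n" where "e = axis undefined 1"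
  have e: "norm e = 1" "e \<bullet> e = 1" by (simp_all add: e_def norm_axis_1 inner_axis_axis)
  obtain N where N: "\<And>k. N k \<ge> 1"
    and dim_0: "\<And>X. X \<subseteq> {x. x \<bullet> e \<in> avoiding_set N \<delta>} \<Longrightarrow> fourier_dim X = 0"
    by (rule ex_frequencies_fourier_dim_eq_0[where \<delta> = \<delta>, OF e(1) \<delta>_pos \<delta>_le]) (rule that)
  define K where "K = avoiding_set N \<delta>"
  have K_closed: "closed K" unfolding K_def by (rule closed_avoiding_set)
  have K_subset: "K \<subseteq> {0..1}" by (auto simp: K_def avoiding_set_def)
  have K_pos: "emeasure lebesgue K > 0"
    unfolding K_def
  proof (rule emeasure_avoiding_set_pos)
    show "(\<Sum>k. \<delta> k) < 1 / 4" using sums_unique[OF \<delta>_sums] by simp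
  qed (use N \<delta>_pos less_imp_le sums_summable[OF \<delta>_sums] in auto)
  define U where "U = {x \<in> cball 0 3. x \<bullet> e \<in> K}"
  have "closed ((\<lambda>x. x \<bullet> e) -` K)"
    using K_closed by (intro continuous_closed_vimage continuous_intros)
  then have "compact (cball 0 3 \<inter> (\<lambda>x. x \<bullet> e) -` K)" by (intro compact_Int_closed) auto
  also have "cball 0 3 \<inter> (\<lambda>x. x \<bullet> e) -` K = U" by (auto simp: U_def)
  finally have compact: "compact U" .
  have dim: "fourier_dim U = 0" by (rule dim_0) (auto simp: U_def K_def)
  \<comment> \<open>The balls lie on opposite sides of the slab that contains \<open>U\<close>, and inside \<open>cball 0 3\<close>.\<close>
  define L where "L = {l \<in> affine_lines. l \<inter> ball (- e) 1 \<noteq> {}} \<inter>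
    {l \<in> affine_lines. l \<inter> ball (2 *\<^sub>R e) 1 \<noteq> {}}"
  have "openin line_topology L"
    unfolding L_def by (intro openin_Int openin_lines_meeting open_ball)
  then have "line_topology interior_of L = L" by (rule interior_of_openin)
  moreover have "line_through 0 e \<in> L"
  proof -
    have "- e \<in> line_through 0 e" "2 *\<^sub>R e \<in> line_through 0 e"
      by (auto simp: line_through_def image_iff intro: exI[of _ "-1"])
    moreover have "e \<noteq> 0" using e(1) by auto
    then have "line_through 0 e \<in> affine_lines" by (auto simp: affine_lines_eq)
    moreover have "- e \<in> ball (- e) 1" "2 *\<^sub>R e \<in> ball (2 *\<^sub>R e) 1" by simp_all
    ultimately show ?thesis unfolding L_def by blast
  qed
  moreover have "line_length l (U \<inter> l) > 0" if "l \<in> L" for l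
  proof -
    from that obtain p q where l: "l \<in> affine_lines" "p \<in> l" "q \<in> l"
      and p: "dist (- e) p < 1" and q: "dist (2 *\<^sub>R e) q < 1" by (auto simp: L_def)
    have "norm (p - - e) < 1" "norm (q - 2 *\<^sub>R e) < 1"
      using p q by (simp_all only: dist_norm norm_minus_commute)
    then have "\<bar>(p - - e) \<bullet> e\<bar> < 1" "\<bar>(q - 2 *\<^sub>R e) \<bullet> e\<bar> < 1"
      using Cauchy_Schwarz_ineq2[of "p - - e" e] Cauchy_Schwarz_ineq2[of "q - 2 *\<^sub>R e" e] e(1)
      by simp_all
    then have "p \<bullet> e < 0" "1 < q \<bullet> e" by (auto simp: inner_add_left inner_diff_left e(2))
    moreover have "p \<in> cball 0 3" "q \<in> cball 0 3"
      using p q norm_triangle_ineq2[of p "- e"] norm_triangle_ineq2[of q "2 *\<^sub>R e"] e(1)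
      by (auto simp: dist_norm norm_minus_commute)
    ultimately show ?thesis unfolding U_def
      by (intro line_length_slab[OF l _ _ convex_cball _ _ K_subset K_pos])
  qed
  ultimately show ?thesis using compact dim
    by (intro exI[of _ U] conjI exI[of _ L]) (auto simp: L_def)
qed

end
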